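(* For any $n,m\in\mathbb{N}$, $$\underline{\square}_1\big(SO(n),SO(m)\big)\ \ge\ \min\Big\{\frac12,\ |\operatorname{diam}SO(n)-\operatorname{diam}SO(m)|\Big\}.$$
   Context: An mm-space is a triple $(X,d_X,\mu_X)$ where $d_X$ is a complete separable metric on $X$ and $\mu_X$ is a finite Borel measure on $X$. For an mm-space with $\mu_X(X)=1$, a parameter of $X$ is a Borel measurable map $\varphi:[0,1]\to X$ with $\varphi_*(\mathcal{L})=\mu_X$, where $\mathcal{L}$ is Lebesgue measure on $[0,1]$; parameters always exist. For two functions $d_1,d_2:[0,1]\times[0,1]\to\mathbb{R}$, $\square_1(d_1,d_2)$ is the infimum of all $\varepsilon>0$ such that there is a measurable set $T_\varepsilon\subseteq[0,1]$ with $\mathcal{L}(T_\varepsilon)\ge 1-\varepsilon$ and $|d_1(s,t)-d_2(s,t)|\le\varepsilon$ for all $s,t\in T_\varepsilon$. Gromov's box distance between two mm-spaces $X,Y$ with $\mu_X(X)=\mu_Y(Y)=1$ is $\underline{\square}_1(X,Y):=\inf\square_1(\varphi_X^*d_X,\varphi_Y^*d_Y)$, where the infimum is over all parameters $\varphi_X$ of $X$ and $\varphi_Y$ of $Y$, and $\varphi_X^*d_X(s,t):=d_X(\varphi_X(s),\varphi_X(t))$. The special orthogonal group $SO(n)$ is regarded as an mm-space with the distance $d_n(A,B)=\|A-B\|_{HS}$ induced by the Hilbert–Schmidt norm $\|A\|_{HS}=\sqrt{\operatorname{tr}(A^{T}A)}$ on $n\times n$ real matrices, and with its Haar probability measure;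 $\operatorname{diam}SO(n)$ is the diameter with respect to $d_n$. $\mathbb{N}$ denotes the positive integers. *)

theory Defs
  imports "HOL-Probability.Probability"
begin

section \<open>mm-spaces and the box distance\<close>

text \<open>
  An mm-space is given by a measure \<^term>\<open>\<mu>\<close> and a distance function \<^term>\<open>d\<close>;
  the underlying set is \<^term>\<open>space \<mu>\<close>.
\<close>

locale mm_space = Metric_space "space \<mu>" d + finite_measure \<mu>
  for d :: "'a \<Rightarrow> 'a \<Rightarrow> real" and \<mu> :: "'a measure" +
  assumes complete: mcomplete
    and separable: "separable_space mtopology"
    and sets_borel: "sets \<mu> = sigma_sets (space \<mu>) {U. openin mtopology U}"

definition mm_parameters :: "'a measure \<Rightarrow> (real \<Rightarrow> 'a) set" where
  "mm_parameters \<mu> =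
     {\<phi> \<in> restrict_space lborel {0..1} \<rightarrow>\<^sub>M \<mu>. distr (restrict_space lborel {0..1}) \<mu> \<phi> = \<mu>}"

text \<open>
  The infimum is over a nonempty set of positive reals: \<^term>\<open>T = {}\<close> shows that it contains \<^term>\<open>1\<close>.
\<close>

definition square1 :: "(real \<Rightarrow> real \<Rightarrow> real) \<Rightarrow> (real \<Rightarrow> real \<Rightarrow> real) \<Rightarrow> real" where
  "square1 d1 d2 = Inf {\<epsilon>. \<epsilon> > 0 \<and>
     (\<exists>T \<in> sets lebesgue. T \<subseteq> {0..1} \<and> measure lebesgue T \<ge> 1 - \<epsilon> \<and>
        (\<forall>s\<in>T. \<forall>t\<in>T. \<bar>d1 s t - d2 s t\<bar> \<le> \<epsilon>))}"

definition pullback_dist :: "('s \<Rightarrow> 'a) \<Rightarrow> ('a \<Rightarrow> 'a \<Rightarrow> real) \<Rightarrow> 's \<Rightarrow> 's \<Rightarrow> real" where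
  "pullback_dist \<phi> d s t = d (\<phi> s) (\<phi> t)"

text \<open>
  The infimum over the parameters is taken in \<^typ>\<open>ereal\<close>, so that it is the infimum in the order
  sense without a separate proof that parameters exist.  It is a number in \<^term>\<open>{0..1::ereal}\<close> as
  soon as both sets of parameters are nonempty, which holds for all mm-spaces of total mass 1.
\<close>

definition box_distance ::
  "('a \<Rightarrow> 'a \<Rightarrow> real) \<Rightarrow> 'a measure \<Rightarrow> ('b \<Rightarrow> 'b \<Rightarrow> real) \<Rightarrow> 'b measure \<Rightarrow> ereal" where
  "box_distance dX \<mu>X dY \<mu>Y =
     (INF \<phi> \<in> mm_parameters \<mu>X. INF \<psi> \<in> mm_parameters \<mu>Y.
        ereal (square1 (pullback_dist \<phi> dX) (pullback_dist \<psi> dY)))"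


section \<open>The special orthogonal group\<close>

definition SO :: "(real^'n^'n) set" where
  "SO = {A. orthogonal_matrix A \<and> det A = 1}"

definition hs_norm :: "real^'n^'n \<Rightarrow> real" where
  "hs_norm A = sqrt (trace (transpose A ** A))"

definition hs_dist :: "real^'n^'n \<Rightarrow> real^'n^'n \<Rightarrow> real" where
  "hs_dist A B = hs_norm (A - B)"

text \<open>A least upper bound, since \<^term>\<open>SO\<close> is nonempty and bounded.\<close>

definition diam_SO :: "'n::finite itself \<Rightarrow> real" where
  "diam_SO _ = (SUP (A, B) \<in> SO \<times> SO. hs_dist A (B :: real^'n^'n))"

text \<open>
  Left-invariant Borel probability measures.  As the group is compact, there is exactly one, the
  Haar probability measure.
\<close>

definition haar_probability_SO :: "(real^'n^'n) measure \<Rightarrow> bool" where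
  "haar_probability_SO \<mu> \<longleftrightarrow>
     prob_space \<mu> \<and> space \<mu> = SO \<and> sets \<mu> = sets (restrict_space borel SO) \<and>
     (\<forall>g\<in>SO. \<forall>A\<in>sets \<mu>. emeasure \<mu> ((\<lambda>x. g ** x) ` A) = emeasure \<mu> A)"

lemma hs_norm_eq_norm: "hs_norm A = norm A"
proof -
  have "trace (transpose A ** A) = (\<Sum>i\<in>UNIV. \<Sum>k\<in>UNIV. (A $ k $ i)\<^sup>2)"
    by (simp add: trace_def matrix_matrix_mult_def transpose_def power2_eq_square)
  also have "\<dots> = (\<Sum>k\<in>UNIV. \<Sum>i\<in>UNIV. (A $ k $ i)\<^sup>2)"
    by (rule sum.swap)
  also have "\<dots> = (norm A)\<^sup>2"
    unfolding power2_norm_eq_inner by (simp add: inner_vec_def power2_eq_square)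
  finally show ?thesis
    by (simp add: hs_norm_def)
qed

lemma hs_dist_eq_dist: "hs_dist = dist"
  by (intro ext) (simp add: hs_dist_def hs_norm_eq_norm dist_norm)

lemma closed_SO: "closed (SO :: (real^'n^'n) set)"
proof -
  have c1: "closed {A :: real^'n^'n. transpose A ** A = mat 1}"
    unfolding transpose_def matrix_matrix_mult_def
    by (intro closed_Collect_eq continuous_intros)
  have c2: "closed {A :: real^'n^'n. det A = 1}"
    unfolding det_def by (intro closed_Collect_eq continuous_intros)
  have eq: "(SO :: (real^'n^'n) set) =
      {A. transpose A ** A = mat 1} \<inter> {A. det A = 1}"
    by (auto simp: SO_def orthogonal_matrix)
  show ?thesis
    unfolding eq by (rule closed_Int[OF c1 c2])
qed

lemma mm_space_SO:
  fixes \<mu> :: "(real^'n^'n) measure"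
  assumes "haar_probability_SO \<mu>"
  shows "mm_space hs_dist \<mu>"
proof -
  have sp: "space \<mu> = SO" and st: "sets \<mu> = sets (restrict_space borel SO)"
    using assms by (auto simp: haar_probability_SO_def)
  interpret prob_space \<mu>
    using assms by (simp add: haar_probability_SO_def)
  interpret S: Submetric UNIV dist "SO :: (real^'n^'n) set"
    by unfold_locales auto
  have top: "S.sub.mtopology = top_of_set SO"
    by (simp add: S.mtopology_submetric)
  have compl: "S.sub.mcomplete"
    unfolding S.sub.mcomplete_def
  proof (intro allI impI)
    fix \<sigma> :: "nat \<Rightarrow> real^'n^'n" assume \<sigma>: "S.sub.MCauchy \<sigma>"
    hence r: "range \<sigma> \<subseteq> SO" and "Cauchy \<sigma>"
      by (auto simp: S.sub.MCauchy_def Cauchy_def)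
    then obtain l where l: "\<sigma> \<longlonglongrightarrow> l"
      using convergent_eq_Cauchy by blast
    moreover have "l \<in> SO"
      using closed_sequentially[OF closed_SO _ l] r by auto
    ultimately have "limitin S.sub.mtopology \<sigma> l sequentially"
      using r by (auto simp: top limitin_subtopology intro!: always_eventually)
    thus "\<exists>x. limitin S.sub.mtopology \<sigma> x sequentially" ..
  qed
  have sep: "separable_space S.sub.mtopology"
  proof -
    obtain T :: "(real^'n^'n) set" where "countable T" "T \<subseteq> SO" "SO \<subseteq> closure T"
      using separable[of "SO :: (real^'n^'n) set"] by blast
    thus ?thesis
      unfolding top separable_space_def
      by (intro exI[of _ T]) (auto simp: closure_of_subtopology Int_absorb1)
  qed
  have bor: "sets \<mu> = sigma_sets (space \<mu>) {U. openin S.sub.mtopology U}"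
  proof -
    have "sets (restrict_space borel SO) =
        sigma_sets SO {U :: (real^'n^'n) set. openin (top_of_set SO) U}"
    proof -
      have "SO \<in> sigma_sets UNIV {S :: (real^'n^'n) set. open S}"
        using borel_closed[OF closed_SO] by (simp add: borel_def)
      hence "sets (restrict_space borel SO) =
          sigma_sets SO ((\<inter>) SO ` {S :: (real^'n^'n) set. open S})"
        by (simp add: sets_restrict_space borel_def sigma_sets_Int)
      also have "(\<inter>) SO ` {S :: (real^'n^'n) set. open S} = {U. openin (top_of_set SO) U}"
        by (auto simp: openin_open)
      finally show ?thesis .
    qed
    thus ?thesis
      by (simp add: sp st top)
  qed
  show ?thesis
    unfolding mm_space_def mm_space_axioms_def hs_dist_eq_dist sp
    by (intro conjI S.sub.Metric_space_axioms finite_measure_axioms compl sep bor[unfolded sp])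
qed

end

theory Submission
  imports Defs
begin

text \<open>
  For \<open>g\<close> in \<open>SO(n)\<close> the distance from \<open>A\<close> to \<open>gA\<close> is the Hilbert-Schmidt norm of \<open>1 - g\<close>, whatever
  \<open>A\<close> is, and \<open>g\<close> can be chosen to make it almost the diameter.  If \<open>T \<subseteq> [0,1]\<close> has measure
  more than \<open>1/2\<close>, then so has the closure \<open>E\<close> of \<open>\<phi>(T)\<close>.  By invariance \<open>E\<close> and \<open>gE\<close>
  intersect, so \<open>\<phi>(T)\<close> contains pairs at distance almost the diameter of \<open>SO(n)\<close>, whereas a
  parameter of \<open>SO(m)\<close> puts them at distance at most the diameter of \<open>SO(m)\<close>.
\<close>

lemma matrix_diff_rdistrib: "(A - B) ** C = A ** C - B ** (C :: real^'p^'n)"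
  for A B :: "real^'n^'m"
  by (simp add: matrix_matrix_mult_def vec_eq_iff left_diff_distrib sum_subtractf)

text \<open>Cyclicity of the trace brings \<open>A\<close> next to its transpose, where the two
  cancel. This makes the distance right-invariant.\<close>

lemma hs_norm_mult_orthogonal:
  fixes M A :: "real^'n^'n"
  assumes "orthogonal_matrix A"
  shows "hs_norm (M ** A) = hs_norm M"
proof -
  have "trace (transpose (M ** A) ** (M ** A)) = trace (transpose A ** (transpose M ** M ** A))"
    by (simp add: matrix_transpose_mul matrix_mul_assoc)
  also have "\<dots> = trace ((transpose M ** M ** A) ** transpose A)"
    by (rule trace_mul_sym)
  also have "\<dots> = trace (transpose M ** M)"
    using assms by (simp add: orthogonal_matrix_def flip: matrix_mul_assoc)
  finally show ?thesis
    by (simp add: hs_norm_def)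
qed

lemma SO_mult: "A \<in> SO \<Longrightarrow> B \<in> SO \<Longrightarrow> A ** B \<in> SO"
  by (simp add: SO_def orthogonal_matrix_mul det_mul)

lemma SO_transpose: "A \<in> SO \<Longrightarrow> transpose A \<in> SO"
  by (simp add: SO_def det_transpose)

lemma SO_transpose_mult: "A \<in> SO \<Longrightarrow> transpose A ** A = mat 1"
  by (simp add: SO_def orthogonal_matrix_def)

lemma mat_1_in_SO: "mat 1 \<in> SO"
  by (simp add: SO_def orthogonal_matrix_id)

text \<open>The case \<open>M = mat 1\<close> of the invariance puts \<open>SO\<close> on a sphere,
  which supplies the bound for compactness.\<close>

lemma norm_SO:
  fixes A :: "real^'n^'n"
  assumes "A \<in> SO"
  shows "norm A = norm (mat 1 :: real^'n^'n)"
  using hs_norm_mult_orthogonal[of A "mat 1"] assms by (simp add: SO_def hs_norm_eq_norm)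

lemma compact_SO: "compact (SO :: (real^'n^'n) set)"
  unfolding compact_eq_bounded_closed bounded_iff
  using closed_SO norm_SO by (metis order_refl)

text \<open>Needed to apply the rules for suprema of reals to \<open>diam_SO\<close>.\<close>

lemma bdd_above_hs_dist_SO:
  "bdd_above ((\<lambda>(A, B). hs_dist A B) ` ((SO :: (real^'n^'n) set) \<times> SO))"
proof (rule bdd_aboveI2)
  fix p :: "(real^'n^'n) \<times> (real^'n^'n)" assume "p \<in> SO \<times> SO"
  then show "(case p of (A, B) \<Rightarrow> hs_dist A B) \<le> diameter (SO :: (real^'n^'n) set)"
    using diameter_bounded_bound[OF compact_imp_bounded[OF compact_SO]]
    by (auto simp: hs_dist_eq_dist)
qed

lemma hs_dist_le_diam_SO:
  fixes A B :: "real^'n^'n"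
  assumes "A \<in> SO" "B \<in> SO"
  shows "hs_dist A B \<le> diam_SO TYPE('n)"
  unfolding diam_SO_def
  using cSUP_upper[OF _ bdd_above_hs_dist_SO, of "(A, B)"] assms by auto

lemma ex_translation_near_diam_SO:
  assumes "e < diam_SO TYPE('n)"
  obtains g :: "real^'n^'n" where "g \<in> SO" "\<And>A. A \<in> SO \<Longrightarrow> e < hs_dist A (g ** A)"
proof -
  obtain B C :: "real^'n^'n" where BC: "B \<in> SO" "C \<in> SO" "e < hs_dist B C"
    using assms mat_1_in_SO less_cSUP_iff[OF _ bdd_above_hs_dist_SO, of e]
    unfolding diam_SO_def by fastforce
  \<comment> \<open>This \<open>g\<close> carries \<open>B\<close> to \<open>C\<close>; since left
    translation by \<open>g\<close> moves all points of \<open>SO\<close> equally far, the common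
    displacement is \<open>hs_dist B C\<close>.\<close>
  define g where "g = C ** transpose B"
  have *: "hs_dist A (g ** A) = hs_norm (mat 1 - g)" if "A \<in> SO" for A
    using hs_norm_mult_orthogonal[of A "mat 1 - g"] that
    by (simp add: hs_dist_def matrix_diff_rdistrib SO_def)
  have "g ** B = C"
    using BC by (simp add: g_def SO_transpose_mult flip: matrix_mul_assoc)
  then have "e < hs_norm (mat 1 - g)"
    using *[of B] BC by simp
  moreover have "g \<in> SO"
    unfolding g_def using BC by (intro SO_mult SO_transpose)
  ultimately show thesis
    using that * by metis
qed

lemma parameter_in_SO:
  assumes "haar_probability_SO \<mu>" "\<phi> \<in> mm_parameters \<mu>" "s \<in> {0..1}"
  shows "\<phi> s \<in> SO"
  using assms by (auto simp: mm_parameters_def haar_probability_SO_def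
      dest!: measurable_space[of _ _ _ s] simp: space_restrict_space)

text \<open>The image of \<open>T\<close> may fail to be measurable, so a measurable superset
  \<open>E\<close> stands in for it. Its preimage is Borel, contains \<open>T\<close> and has the
  measure of \<open>E\<close>.\<close>

lemma measure_le_measure_parameter:
  assumes \<phi>: "\<phi> \<in> mm_parameters \<mu>"
    and T: "T \<in> sets lebesgue" "T \<subseteq> {0..1}"
    and E: "E \<in> sets \<mu>" "\<phi> ` T \<subseteq> E"
  shows "measure lebesgue T \<le> measure \<mu> E"
proof -
  let ?I = "restrict_space lborel {0..1::real}"
  have meas: "\<phi> \<in> measurable ?I \<mu>" and distr: "distr ?I \<mu> \<phi> = \<mu>"
    using \<phi> by (auto simp: mm_parameters_def)
  define P where "P = \<phi> -` E \<inter> {0..1}"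
  have "P \<in> sets ?I"
    using measurable_sets[OF meas E(1)] by (simp add: P_def space_restrict_space)
  then have P: "P \<in> sets lborel"
    by (simp add: sets_restrict_space_iff)
  have "measure \<mu> E = measure ?I P"
    using measure_distr[OF meas E(1)] distr by (simp add: P_def space_restrict_space)
  also have "\<dots> = measure lborel P"
    by (rule measure_restrict_space) (auto simp: P_def)
  also have "\<dots> = measure lebesgue P"
    using P by (simp add: measure_completion)
  finally have "measure \<mu> E = measure lebesgue P" .
  moreover have "measure lebesgue T \<le> measure lebesgue P"
  proof (rule measure_mono_fmeasurable)
    show "P \<in> lmeasurable"
      using P by (intro bounded_set_imp_lmeasurable bounded_subset[OF bounded_closed_interval[of 0 1]])
        (auto simp: P_def)
  qed (use T E in \<open>auto simp: P_def\<close>)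
  ultimately show ?thesis by simp
qed

lemma ex_pair_near_diam_SO:
  fixes \<mu> :: "(real^'n^'n) measure"
  assumes \<mu>: "haar_probability_SO \<mu>" and \<phi>: "\<phi> \<in> mm_parameters \<mu>"
    and T: "T \<in> sets lebesgue" "T \<subseteq> {0..1}" "measure lebesgue T > 1/2"
    and e: "e < diam_SO TYPE('n)"
  shows "\<exists>s\<in>T. \<exists>t\<in>T. e < hs_dist (\<phi> s) (\<phi> t)"
proof -
  interpret prob_space \<mu>
    using \<mu> by (simp add: haar_probability_SO_def)
  have closed_sets: "K \<in> sets \<mu>" if "closed K" "K \<subseteq> SO" for K
    using \<mu> that by (simp add: haar_probability_SO_def sets_restrict_space_iff closed_SO)
  obtain g :: "real^'n^'n" where g: "g \<in> SO" "\<And>A. A \<in> SO \<Longrightarrow> e < hs_dist A (g ** A)"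
    using ex_translation_near_diam_SO[OF e] by blast
  define E where "E = closure (\<phi> ` T)"
  have ESO: "E \<subseteq> SO"
    unfolding E_def using parameter_in_SO[OF \<mu> \<phi>] T(2) closed_SO
    by (intro closure_minimal) auto
  then have Em: "E \<in> sets \<mu>"
    by (intro closed_sets) (auto simp: E_def)
  \<comment> \<open>Compactness passes to the translate of \<open>E\<close> by continuity, so the
    translate is closed and therefore measurable.\<close>
  have "compact E"
    using ESO compact_SO closed_Int_compact[of E SO] by (simp add: E_def Int_absorb2)
  then have "compact ((\<lambda>x. g ** x) ` E)"
    unfolding matrix_matrix_mult_def
    by (intro compact_continuous_image continuous_intros)
  then have gEm: "(\<lambda>x. g ** x) ` E \<in> sets \<mu>"
    using ESO g SO_mult by (intro closed_sets) (auto simp: compact_imp_closed)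
  have half: "measure \<mu> E > 1/2"
    using measure_le_measure_parameter[OF \<phi> T(1,2) Em] T(3) closure_subset[of "\<phi> ` T"]
    by (simp add: E_def)
  moreover have "measure \<mu> ((\<lambda>x. g ** x) ` E) = measure \<mu> E"
    using \<mu> g Em by (simp add: haar_probability_SO_def measure_def)
  \<comment> \<open>If disjoint, the two sets would have total mass above 1.\<close>
  ultimately have "E \<inter> (\<lambda>x. g ** x) ` E \<noteq> {}"
    using finite_measure_Union[OF Em gEm] prob_le_1[of "E \<union> (\<lambda>x. g ** x) ` E"] by linarith
  then obtain A where A: "A \<in> E" "g ** A \<in> E"
    by auto
  then have "e < hs_dist A (g ** A)"
    using g ESO by auto
  \<comment> \<open>Half the slack: replacing \<open>A\<close> and \<open>g ** A\<close> by points
    of the image of \<open>T\<close> within \<open>r\<close> costs less than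
    \<open>2 * r\<close>.\<close>
  moreover define r where "r = (hs_dist A (g ** A) - e) / 2"
  ultimately have "r > 0" by simp
  then obtain s t where st: "s \<in> T" "t \<in> T" "dist (\<phi> s) A < r" "dist (\<phi> t) (g ** A) < r"
    using A unfolding E_def closure_approachable by blast
  have "dist A (g ** A) \<le> dist (\<phi> s) A + dist (\<phi> s) (\<phi> t) + dist (\<phi> t) (g ** A)"
    using dist_triangle[of A "g ** A" "\<phi> s"] dist_triangle[of "\<phi> s" "g ** A" "\<phi> t"]
    by (simp add: dist_commute)
  with st have "e < hs_dist (\<phi> s) (\<phi> t)"
    by (simp add: r_def hs_dist_eq_dist field_simps)
  with st show ?thesis by blast
qed

text \<open>One-sided, so that exchanging the two groups yields the bound on the absolute
  difference. If it failed, \<open>diam_SO TYPE('m) + \<epsilon>\<close> would lie below the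
  diameter of the first group, and some pair in \<open>T\<close> would exceed it.\<close>

lemma diam_SO_le_diam_SO_add:
  fixes \<mu> :: "(real^'n^'n) measure" and \<nu> :: "(real^'m^'m) measure"
  assumes "haar_probability_SO \<mu>" "haar_probability_SO \<nu>"
    and "\<phi> \<in> mm_parameters \<mu>" "\<psi> \<in> mm_parameters \<nu>"
    and T: "T \<in> sets lebesgue" "T \<subseteq> {0..1}" "measure lebesgue T > 1/2"
    and close: "\<And>s t. s \<in> T \<Longrightarrow> t \<in> T \<Longrightarrow> hs_dist (\<phi> s) (\<phi> t) \<le> hs_dist (\<psi> s) (\<psi> t) + \<epsilon>"
  shows "diam_SO TYPE('n) \<le> diam_SO TYPE('m) + \<epsilon>"
proof (rule ccontr)
  assume "\<not> ?thesis"
  then obtain s t where st: "s \<in> T" "t \<in> T" "diam_SO TYPE('m) + \<epsilon> < hs_dist (\<phi> s) (\<phi> t)"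
    using ex_pair_near_diam_SO[OF assms(1,3) T] by (meson not_le)
  have "hs_dist (\<psi> s) (\<psi> t) \<le> diam_SO TYPE('m)"
    using st T by (intro hs_dist_le_diam_SO parameter_in_SO[OF assms(2,4)]) auto
  with st close[of s t] show False by simp
qed

theorem lemma3p7:
  fixes \<mu> :: "(real^'n^'n) measure" and \<nu> :: "(real^'m^'m) measure"
  assumes "haar_probability_SO \<mu>" and "haar_probability_SO \<nu>"
  shows "box_distance hs_dist \<mu> hs_dist \<nu> \<ge>
    ereal (min (1/2) \<bar>diam_SO TYPE('n) - diam_SO TYPE('m)\<bar>)"
  unfolding box_distance_def
proof (intro INF_greatest, unfold ereal_less_eq square1_def, rule cInf_greatest, goal_cases)
  case (1 \<phi> \<psi>)
  \<comment> \<open>The set is nonempty: \<open>T = {}\<close> is admissible for the value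
    1.\<close>
  show ?case
    by (rule notI, drule equals0D[of _ 1]) (auto dest: bspec[of _ _ "{}"])
next
  case (2 \<phi> \<psi> \<epsilon>)
  then obtain T where T: "T \<in> sets lebesgue" "T \<subseteq> {0..1}" "measure lebesgue T \<ge> 1 - \<epsilon>"
    and close: "\<And>s t. s \<in> T \<Longrightarrow> t \<in> T \<Longrightarrow> \<bar>hs_dist (\<phi> s) (\<phi> t) - hs_dist (\<psi> s) (\<psi> t)\<bar> \<le> \<epsilon>"
    by (auto simp: pullback_dist_def)
  \<comment> \<open>Below 1/2, \<open>T\<close> has measure above 1/2 and both one-sided bounds
    apply; otherwise the entry 1/2 of the minimum suffices.\<close>
  have "\<bar>diam_SO TYPE('n) - diam_SO TYPE('m)\<bar> \<le> \<epsilon>" if "\<epsilon> < 1/2"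
  proof -
    have half: "measure lebesgue T > 1/2"
      using T(3) that by simp
    have "diam_SO TYPE('n) \<le> diam_SO TYPE('m) + \<epsilon>"
      by (rule diam_SO_le_diam_SO_add[OF assms 2(1,2) T(1,2) half]) (use close in force)
    moreover have "diam_SO TYPE('m) \<le> diam_SO TYPE('n) + \<epsilon>"
      by (rule diam_SO_le_diam_SO_add[OF assms(2,1) 2(2,1) T(1,2) half]) (use close in force)
    ultimately show ?thesis by linarith
  qed
  then show ?case by linarith
qed

end
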